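(* Let $m>n\ge 0$ be integers and let $\varphi(z)=z^{m}\bar{z}^{n}$ on $\mathbb{D}$. Then the Toeplitz operator $T_{z^{m}\bar{z}^{n}}=T_{\varphi}$ on the Bergman space $A^{2}(\mathbb{D})$ satisfies \[ \left\Vert [T_{z^{m}\bar{z}^{n}}^{*},T_{z^{m}\bar{z}^{n}}]\right\Vert\le\frac{1}{2}. \]
   Context: $\mathbb{D}$ is the open unit disc in $\mathbb{C}$. The Bergman space is $A^{2}(\mathbb{D})=\{f \text{ holomorphic on }\mathbb{D}:\int_{\mathbb{D}}|f(z)|^{2}\,dA(z)<\infty\}$, where $dA$ is area measure, regarded as a closed subspace of $L^{2}(\mathbb{D})$. For $\varphi\in L^{\infty}(\mathbb{D})$, the Toeplitz operator is $T_{\varphi}f=P(\varphi f)$ for $f\in A^{2}(\mathbb{D})$, where $P$ is the orthogonal projection from $L^{2}(\mathbb{D})$ onto $A^{2}(\mathbb{D})$. For a bounded operator $T$, $[T^{*},T]:=T^{*}T-TT^{*}$, and $\Vert\cdot\Vert$ is the operator norm. *)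

theory Defs
  imports "HOL-Complex_Analysis.Complex_Analysis"
begin

abbreviation unit_disc :: "complex set"
  where "unit_disc \<equiv> ball 0 1"

definition disc_area :: "complex measure"
  where "disc_area = lebesgue_on unit_disc"

text \<open>Square-integrable functions; almost-everywhere equal functions are not identified.\<close>

definition L2_disc :: "(complex \<Rightarrow> complex) set"
  where "L2_disc = {f \<in> borel_measurable disc_area. integrable disc_area (\<lambda>z. (cmod (f z))\<^sup>2)}"

definition L2_inner :: "(complex \<Rightarrow> complex) \<Rightarrow> (complex \<Rightarrow> complex) \<Rightarrow> complex"
  where "L2_inner f g = (LINT z|disc_area. f z * cnj (g z))"

definition L2_norm :: "(complex \<Rightarrow> complex) \<Rightarrow> real"
  where "L2_norm f = sqrt (LINT z|disc_area. (cmod (f z))\<^sup>2)"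

text \<open>
  A function on the disc is represented by its extension by zero, so that two elements of the
  Bergman space are equal as HOL functions iff they agree on the disc.
\<close>

definition bergman_space :: "(complex \<Rightarrow> complex) set"
  where "bergman_space = {f \<in> L2_disc. f holomorphic_on unit_disc \<and> (\<forall>z. z \<notin> unit_disc \<longrightarrow> f z = 0)}"

text \<open>
  The orthogonal projection of \<open>g \<in> L2_disc\<close> is the unique element of the closed subspace
  \<open>bergman_space\<close> whose difference from \<open>g\<close> is orthogonal to \<open>bergman_space\<close>; the value is meaningful only
  for \<open>g \<in> L2_disc\<close>.
\<close>

definition bergman_proj :: "(complex \<Rightarrow> complex) \<Rightarrow> (complex \<Rightarrow> complex)"
  where "bergman_proj g =
    (THE f. f \<in> bergman_space \<and> (\<forall>h\<in>bergman_space. L2_inner (\<lambda>z. g z - f z) h = 0))"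

text \<open>Operators on \<open>bergman_space\<close> are HOL functions of which only the values on \<open>bergman_space\<close> matter.\<close>

type_synonym bergman_op = "(complex \<Rightarrow> complex) \<Rightarrow> (complex \<Rightarrow> complex)"

definition toeplitz :: "(complex \<Rightarrow> complex) \<Rightarrow> bergman_op"
  where "toeplitz \<phi> f = bergman_proj (\<lambda>z. \<phi> z * f z)"

text \<open>
  The Hilbert space adjoint: for bounded \<open>T\<close> on \<open>bergman_space\<close>, the vector below exists and is unique
  for every \<open>g \<in> bergman_space\<close> (Riesz representation).
\<close>

definition bergman_adjoint :: "bergman_op \<Rightarrow> bergman_op"
  where "bergman_adjoint T g =
    (THE h. h \<in> bergman_space \<and> (\<forall>f\<in>bergman_space. L2_inner (T f) g = L2_inner f h))"

definition op_commutator :: "bergman_op \<Rightarrow> bergman_op \<Rightarrow> bergman_op"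
  where "op_commutator S T f = (\<lambda>z. S (T f) z - T (S f) z)"

text \<open>Extended-valued, so that the norm of an unbounded operator is \<open>\<infinity>\<close>.\<close>

definition bergman_op_norm :: "bergman_op \<Rightarrow> ennreal"
  where "bergman_op_norm T = (SUP f \<in> {f \<in> bergman_space. L2_norm f \<le> 1}. ennreal (L2_norm (T f)))"

end

theory Submission
  imports Defs
begin

text \<open>
  The operator \<open>T\<close> with symbol \<open>z ^ m * cnj z ^ n\<close> is a weighted shift by \<open>d = m - n\<close> on the orthogonal
  basis of monomials. Indeed the integral of \<open>z ^ p * cnj z ^ q\<close> over the disc vanishes unless \<open>p = q\<close>,
  when it is \<open>pi / (p + 1)\<close>, so that comparing inner products with monomials gives
  \<open>T (z ^ k) = (k + d + 1) / (m + k + 1) * z ^ (k + d)\<close>. The adjoint has the conjugate symbol and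
  is the weighted shift back. Therefore the commutator is diagonal, with eigenvalue
  \<open>x * (x + d) / (y + d)\<^sup>2 - x * max (x - d) 0 / y\<^sup>2\<close> on \<open>z ^ k\<close>, where \<open>x = k + 1\<close> and \<open>y = n + k + 1\<close>.
  Its norm is at most the supremum of the absolute values of these numbers, each of which is at most
  \<open>1 / 2\<close> by an elementary inequality (\<open>abs_commutator_eigenvalue_le\<close>).

  The analytic content is that this computation on monomials determines the operators. Parseval's
  identity \<open>nn_integral_power_series_disc\<close> expresses the norm of a function through its Taylor
  coefficients, and so identifies the Bergman space with a weighted sequence space. It also shows
  that polynomials are dense, so that the projection, given by a definite description, is determined
  by inner products with monomials (\<open>bergman_proj_eqI\<close>). The same kind of uniqueness identifies the
  adjoint (\<open>bergman_adjoint_toeplitz_monomial\<close>), and \<open>commutator_taylor\<close> states that the commutator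
  acts diagonally on Taylor coefficients.
\<close>

unbundle no fps_syntax

section \<open>Integrals of monomials over discs\<close>

text \<open>
  Orthogonal maps of \<open>real ^ 2\<close> preserve area; this identification with the plane carries that over
  to rotations of \<open>complex\<close>.
\<close>

lemma lborel_complex_eq_distr_vec:
  "distr lborel borel (\<lambda>x::real^2. Complex (x $ 1) (x $ 2)) = (lborel :: complex measure)"
proof (rule lborel_eqI[symmetric])
  have [measurable]: "(\<lambda>x::real^2. Complex (x $ 1) (x $ 2)) \<in> borel_measurable borel"
    by (intro borel_measurable_continuous_onI continuous_intros)
  show "sets (distr lborel borel (\<lambda>x::real^2. Complex (x $ 1) (x $ 2))) = sets borel" by simp
  fix l u :: complex
  assume le: "\<And>b. b \<in> Basis \<Longrightarrow> l \<bullet> b \<le> u \<bullet> b"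
  have le': "Re l \<le> Re u" "Im l \<le> Im u"
    using le[of 1] le[of \<i>] by (auto simp: Basis_complex_def)
  have vim: "(\<lambda>x::real^2. Complex (x $ 1) (x $ 2)) -` box l u
      = box (vector [Re l, Im l]) (vector [Re u, Im u])"
    by (auto simp: in_box_complex_iff mem_box_cart forall_2)
  have "emeasure (distr lborel borel (\<lambda>x::real^2. Complex (x $ 1) (x $ 2))) (box l u)
      = emeasure lborel (box (vector [Re l, Im l]) (vector [Re u, Im u] :: real^2))"
    by (subst emeasure_distr) (auto simp: vim)
  also have "\<dots> = ennreal (\<Prod>b\<in>Basis. ((vector [Re u, Im u] :: real^2) - vector [Re l, Im l]) \<bullet> b)"
    using le' by (intro emeasure_lborel_box) (auto simp: Basis_vec_def inner_axis forall_2 exhaust_2 UNIV_2)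
  also have "(\<Prod>b\<in>Basis. ((vector [Re u, Im u] :: real^2) - vector [Re l, Im l]) \<bullet> b)
      = (\<Prod>b\<in>Basis. (u - l) \<bullet> b)"
  proof -
    have B: "(Basis :: (real^2) set) = {axis 1 1, axis 2 1}"
      by (auto simp: Basis_vec_def UNIV_2)
    have "axis 1 1 \<noteq> (axis 2 1 :: real^2)"
      by (simp add: axis_eq_axis)
    then show ?thesis
      unfolding B by (simp add: inner_axis Basis_complex_def)
  qed
  finally show "emeasure (distr lborel borel (\<lambda>x::real^2. Complex (x $ 1) (x $ 2))) (box l u)
      = (\<Prod>b\<in>Basis. (u - l) \<bullet> b)" .
qed

lemma lborel_complex_rotation:
  fixes u :: complex
  assumes u: "cmod u = 1"
  shows "distr lborel borel (\<lambda>z. u * z) = lborel"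
proof (rule lborel_eqI[symmetric])
  show "sets (distr lborel borel ((*) u)) = sets borel" by simp
  fix a b :: complex
  assume le: "\<And>e. e \<in> Basis \<Longrightarrow> a \<bullet> e \<le> b \<bullet> e"
  let ?c = "\<lambda>x::real^2. Complex (x $ 1) (x $ 2)"
  let ?d = "\<lambda>z. vector [Re z, Im z] :: real^2"
  let ?R = "\<lambda>x. ?d (cnj u * ?c x)"
  have cm [measurable]: "?c \<in> borel_measurable borel"
    by (intro borel_measurable_continuous_onI continuous_intros)
  have cd: "?c (?d z) = z" for z by simp
  have dc: "?d (?c x) = x" for x by (simp add: vec_eq_iff forall_2)
  have lin: "linear ?R"
    by (intro linearI) (auto simp: vec_eq_iff forall_2 algebra_simps)
  have nrm: "norm (?d z) = cmod z" for z
    by (simp add: norm_vec_def L2_set_def UNIV_2 cmod_def)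
  have orth: "orthogonal_transformation ?R"
  proof -
    have "norm (?R x) = norm x" for x
    proof -
      have "norm (?R x) = cmod (cnj u * ?c x)" by (rule nrm)
      also have "\<dots> = cmod (?c x)" using u by (simp add: norm_mult)
      also have "\<dots> = norm (?d (?c x))" by (rule nrm[symmetric])
      also have "\<dots> = norm x" by (simp only: dc)
      finally show ?thesis .
    qed
    then show ?thesis using lin by (simp add: orthogonal_transformation)
  qed
  have unit: "cnj u * u = 1" "u * cnj u = 1"
    using u complex_norm_square[of u] by (simp_all add: mult.commute)
  let ?S = "?c -` box a b"
  have S: "?S = box (?d a) (?d b)"
    by (auto simp: in_box_complex_iff mem_box_cart forall_2)
  have pre: "?c -` ((*) u -` box a b) = ?R ` ?S"
  proof (intro set_eqI iffI)
    fix x assume x: "x \<in> ?c -` ((*) u -` box a b)"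
    have "cnj u * (u * ?c x) = ?c x" by (simp only: mult.assoc[symmetric] unit mult_1_left)
    then have "x = ?R (?d (u * ?c x))" by (simp only: cd dc)
    moreover have "?d (u * ?c x) \<in> ?S"
      using x by (simp only: vimage_eq cd)
    ultimately show "x \<in> ?R ` ?S" by (rule image_eqI)
  next
    fix x assume "x \<in> ?R ` ?S"
    then obtain y where y: "x = ?R y" "y \<in> ?S" by (rule imageE)
    then have "u * ?c x = ?c y"
      unfolding y(1) by (simp only: cd mult.assoc[symmetric] unit mult_1_left)
    then show "x \<in> ?c -` ((*) u -` box a b)" using y(2) by (simp only: vimage_eq)
  qed
  have Slm: "?S \<in> lmeasurable" unfolding S by simp
  have RSlm: "?R ` ?S \<in> lmeasurable"
    using orth Slm by (rule measurable_orthogonal_image)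
  have [measurable]: "(*) u -` box a b \<in> sets borel"
    by (rule measurable_sets_borel[of _ borel]) auto
  have bor: "?S \<in> sets borel" "?R ` ?S \<in> sets borel"
    unfolding pre[symmetric] by (auto intro!: measurable_sets_borel[OF cm])
  have lborel_lebesgue: "emeasure lborel A = emeasure lebesgue A" if "A \<in> sets borel" for A :: "(real^2) set"
    using that by simp
  have "emeasure (distr lborel borel ((*) u)) (box a b) = emeasure lborel ((*) u -` box a b)"
    by (subst emeasure_distr) auto
  also have "\<dots> = emeasure (distr lborel borel ?c) ((*) u -` box a b)"
    by (simp add: lborel_complex_eq_distr_vec)
  also have "\<dots> = emeasure lborel (?R ` ?S)"
    by (subst emeasure_distr) (auto simp: pre)
  also have "\<dots> = emeasure lebesgue (?R ` ?S)"
    by (rule lborel_lebesgue[OF bor(2)])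
  also have "\<dots> = emeasure lebesgue ?S"
    by (simp only: emeasure_eq_measure2[OF RSlm] emeasure_eq_measure2[OF Slm] measure_orthogonal_image[OF orth Slm])
  also have "\<dots> = emeasure lborel ?S"
    by (rule lborel_lebesgue[OF bor(1), symmetric])
  also have "\<dots> = emeasure (distr lborel borel ?c) (box a b)"
    by (subst emeasure_distr) auto
  also have "\<dots> = (\<Prod>e\<in>Basis. (b - a) \<bullet> e)"
    using le by (simp add: lborel_complex_eq_distr_vec)
  finally show "emeasure (distr lborel borel ((*) u)) (box a b) = (\<Prod>e\<in>Basis. (b - a) \<bullet> e)" .
qed

text \<open>
  Integration of radial functions in polar coordinates: a thin annulus of radius \<open>t\<close> has area
  \<open>2 * pi * t\<close> times its width. Both measures on the line give the half-line above \<open>x\<close> the area of the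
  annulus between \<open>max x 0\<close> and \<open>r\<close>.
\<close>

lemma distr_cmod_lebesgue_ball:
  fixes r :: real
  assumes r: "0 \<le> r"
  shows "distr (lebesgue_on (ball 0 r)) borel cmod
    = density lborel (\<lambda>t. ennreal (2 * pi * t) * indicator {0..r} t)"
    (is "?M = ?N")
proof (rule measure_eqI_lessThan)
  show "sets ?M = sets borel" "sets ?N = sets borel" by auto
  have ms [measurable]: "cmod \<in> borel_measurable (lebesgue_on (ball 0 r))"
    by (intro continuous_imp_measurable_on_sets_lebesgue continuous_intros) auto
  fix x :: real
  let ?b = "max x 0"
  have E1: "emeasure ?M {x<..} = ennreal (if ?b \<le> r then pi * r\<^sup>2 - pi * ?b\<^sup>2 else 0)"
  proof -
    have eq: "emeasure ?M {x<..} = emeasure lebesgue {z \<in> ball 0 r. x < cmod z}"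
    proof -
      have "cmod -` {x<..} \<inter> space (lebesgue_on (ball 0 r)) = {z \<in> ball 0 r. x < cmod z}" by auto
      then have "emeasure ?M {x<..} = emeasure (lebesgue_on (ball 0 r)) {z \<in> ball 0 r. x < cmod z}"
        by (subst emeasure_distr) auto
      also have "\<dots> = emeasure lebesgue {z \<in> ball 0 r. x < cmod z}"
        by (rule emeasure_restrict_space) auto
      finally show ?thesis .
    qed
    have vol: "emeasure lborel (ball (0::complex) s) = ennreal (pi * s\<^sup>2)"
        "emeasure lborel (cball (0::complex) s) = ennreal (pi * s\<^sup>2)" if "0 \<le> s" for s
      using that by (simp_all add: emeasure_ball emeasure_cball eval_unit_ball_vol)
    show ?thesis
    proof (cases "x < 0")
      case True
      then have "x < cmod z" for z using norm_ge_zero[of z] by linarith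
      then have "{z \<in> ball 0 r. x < cmod z} = ball 0 r" by auto
      then have "emeasure ?M {x<..} = ennreal (pi * r\<^sup>2)"
        using r by (simp only: eq) (simp add: vol)
      then show ?thesis using True r by simp
    next
      case False
      then have *: "{z \<in> ball 0 r. x < cmod z} = ball 0 r - cball 0 x" by auto
      show ?thesis
      proof (cases "x < r")
        case True
        then have "emeasure lebesgue (ball (0::complex) r - cball 0 x) = ennreal (pi * r\<^sup>2) - ennreal (pi * x\<^sup>2)"
          using False r by (subst emeasure_Diff) (auto simp: vol)
        then show ?thesis using True False eq * by (simp add: ennreal_minus max_def)
      next
        case 2: False
        then have "ball (0::complex) r - cball 0 x = {}" by auto
        then have "emeasure ?M {x<..} = 0" unfolding eq * by (rule ssubst[where P="\<lambda>A. emeasure lebesgue A = 0"]) simp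
        moreover have "?b = x" using False by simp
        moreover have "x = r \<or> \<not> x \<le> r" using 2 by auto
        ultimately show ?thesis by (elim disjE) simp_all
      qed
    qed
  qed
  show "emeasure ?M {x<..} < \<infinity>" unfolding E1 by simp
  have "emeasure ?N {x<..} = (\<integral>\<^sup>+t. ennreal (2 * pi * t) * indicator {0..r} t * indicator {x<..} t \<partial>lborel)"
    by (subst emeasure_density) auto
  also have "\<dots> = (\<integral>\<^sup>+t. ennreal (2 * pi * t) * indicator {?b..r} t \<partial>lborel)"
  proof (rule nn_integral_cong_AE, rule AE_mp[OF AE_lborel_singleton[of x] AE_I2], rule impI)
    fix t :: real assume "t \<noteq> x"
    then have "t \<in> {0..r} \<and> t \<in> {x<..} \<longleftrightarrow> t \<in> {?b..r}" by auto
    then show "ennreal (2 * pi * t) * indicator {0..r} t * indicator {x<..} t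
        = ennreal (2 * pi * t) * indicator {?b..r} t"
      by (cases "t \<in> {0..r}"; cases "t \<in> {x<..}") simp_all
  qed
  also have "\<dots> = ennreal (if ?b \<le> r then pi * r\<^sup>2 - pi * ?b\<^sup>2 else 0)"
  proof (cases "?b \<le> r")
    case True
    have "(\<integral>\<^sup>+t. ennreal (2 * pi * t) * indicator {?b..r} t \<partial>lborel) = ennreal (pi * r\<^sup>2 - pi * ?b\<^sup>2)"
      using True by (intro nn_integral_FTC_Icc[where F="\<lambda>t. pi * t\<^sup>2"])
        (auto intro!: derivative_eq_intros)
    then show ?thesis using True by simp
  next
    case False
    then have "{?b..r} = {}" by simp
    then have "(\<integral>\<^sup>+t. ennreal (2 * pi * t) * indicator {?b..r} t \<partial>lborel) = 0"
      by (simp only: indicator_simps(2) empty_iff not_False_eq_True mult_zero_right nn_integral_const mult_zero_left)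
    then show ?thesis using False by (simp only: if_False ennreal_0)
  qed
  finally show "emeasure ?M {x<..} = emeasure ?N {x<..}" by (simp only: E1)
qed

lemma lebesgue_on_ball_finite [simp]: "finite_measure (lebesgue_on (ball (0::complex) r))"
  by (intro finite_measure_lebesgue_on) auto

lemma integrable_bounded_on_ball:
  fixes g :: "complex \<Rightarrow> 'a :: {banach, second_countable_topology}"
  assumes "g \<in> borel_measurable (lebesgue_on (ball 0 r))"
    and "\<And>z. z \<in> ball 0 r \<Longrightarrow> norm (g z) \<le> C"
  shows "integrable (lebesgue_on (ball 0 r)) g"
  using assms by (intro finite_measure.integrable_const_bound[where B=C]) auto

lemma continuous_on_measurable_ball:
  "continuous_on (ball 0 r) (g :: complex \<Rightarrow> 'a::euclidean_space) \<Longrightarrow> g \<in> borel_measurable (lebesgue_on (ball 0 r))"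
  by (rule continuous_imp_measurable_on_sets_lebesgue) auto

lemma monomial_norm_le:
  fixes z :: complex
  assumes "z \<in> ball 0 r" shows "norm (z ^ p * cnj z ^ q) \<le> r ^ (p + q)"
proof -
  have "norm (z ^ p * cnj z ^ q) = cmod z ^ (p + q)"
    by (simp add: norm_mult norm_power power_add)
  also have "\<dots> \<le> r ^ (p + q)" using assms by (intro power_mono) auto
  finally show ?thesis .
qed

text \<open>
  The rotation by the angle \<open>pi / (p - q)\<close> preserves the disc and multiplies the integrand by
  \<open>cis pi = -1\<close>, so the integral equals its own negative.
\<close>

lemma integral_monomial_off_diagonal:
  assumes "p \<noteq> q"
  shows "(LINT z|lebesgue_on (ball 0 r). (z::complex) ^ p * cnj z ^ q) = 0"
proof -
  define e where "e = (of_int p - of_int q :: real)"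
  define u where "u = cis (pi / e)"
  have e: "e \<noteq> 0" using assms by (simp add: e_def)
  have u1: "cmod u = 1" by (simp add: u_def)
  have uu: "u ^ p * cnj u ^ q = -1"
  proof -
    have "u ^ p * cnj u ^ q = cis (real p * (pi / e) + real q * (- (pi / e)))"
      by (simp only: u_def cis_cnj Complex.DeMoivre cis_mult)
    also have "real p * (pi / e) + real q * (- (pi / e)) = pi"
    proof -
      have "real p * (pi / e) + real q * (- (pi / e)) = e * (pi / e)"
        by (simp only: e_def of_int_of_nat_eq ring_distribs)
      then show ?thesis using e by simp
    qed
    finally show ?thesis by simp
  qed
  let ?g = "\<lambda>z::complex. indicator (ball 0 r) z *\<^sub>R (z ^ p * cnj z ^ q)"
  have gm [measurable]: "?g \<in> borel_measurable borel"
    by (intro borel_measurable_scaleR borel_measurable_indicator borel_measurable_continuous_onI continuous_intros) auto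
  have um [measurable]: "(*) u \<in> borel_measurable borel" by simp
  have inv: "?g (u * z) = - ?g z" for z
  proof -
    have "?g (u * z) = (u ^ p * cnj u ^ q) * ?g z"
      using u1 by (simp add: indicator_def norm_mult power_mult_distrib algebra_simps)
    then show ?thesis by (simp add: uu)
  qed
  have I: "(LINT z|lebesgue_on (ball 0 r). (z::complex) ^ p * cnj z ^ q) = (LINT z|lborel. ?g z)"
    by (subst integral_restrict_space) (auto simp: integral_completion)
  also have "\<dots> = (LINT z|distr lborel borel ((*) u). ?g z)"
    by (simp only: lborel_complex_rotation[OF u1])
  also have "\<dots> = (LINT z|lborel. ?g (u * z))"
    by (rule integral_distr) auto
  also have "\<dots> = - (LINT z|lborel. ?g z)"
    by (simp only: inv integral_minus)
  finally show ?thesis using I by simp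
qed

lemma integral_monomial_diagonal:
  assumes "0 \<le> r"
  shows "(LINT z|lebesgue_on (ball (0::complex) r). cmod z ^ (2 * p)) = pi * r ^ (2 * p + 2) / (p + 1)"
proof -
  have ms: "cmod \<in> borel_measurable (lebesgue_on (ball 0 r))"
    by (intro continuous_on_measurable_ball continuous_intros)
  have "(LINT z|lebesgue_on (ball (0::complex) r). cmod z ^ (2 * p))
      = (LINT t|distr (lebesgue_on (ball 0 r)) borel cmod. t ^ (2 * p))"
    by (rule integral_distr[symmetric]) (use ms in auto)
  also have "\<dots> = (LINT t|density lborel (\<lambda>t. ennreal (2 * pi * t * indicator {0..r} t)). t ^ (2 * p))"
  proof -
    have "(\<lambda>t. ennreal (2 * pi * t * indicator {0..r} t)) = (\<lambda>t. ennreal (2 * pi * t) * indicator {0..r} t)"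
      by (auto simp: fun_eq_iff indicator_def)
    then show ?thesis by (simp only: distr_cmod_lebesgue_ball[OF assms])
  qed
  also have "\<dots> = (LINT t|lborel. (2 * pi * t * indicator {0..r} t) *\<^sub>R t ^ (2 * p))"
    by (rule integral_density) (auto simp: indicator_def)
  also have "\<dots> = (LINT t|lborel. (2 * pi) * (t ^ (2 * p + 1) * indicator {0..r} t))"
    by (rule Bochner_Integration.integral_cong) (auto simp: mult_ac)
  also have "\<dots> = 2 * pi * (r ^ (2 * p + 2) / (2 * p + 2))"
    by (subst integral_mult_right_zero, subst integral_power) (use assms in auto)
  also have "\<dots> = pi * r ^ (2 * p + 2) / (p + 1)"
    by (simp add: field_simps)
  finally show ?thesis .
qed

lemma integral_monomial:
  assumes "0 \<le> r"
  shows "(LINT z|lebesgue_on (ball 0 r). (z::complex) ^ p * cnj z ^ q)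
    = (if p = q then of_real (pi * r ^ (2 * p + 2) / (p + 1)) else 0)"
proof (cases "p = q")
  case True
  have "z ^ p * cnj z ^ p = of_real (cmod z ^ (2 * p))" for z
    by (simp add: power_mult_distrib[symmetric] complex_norm_square[symmetric] power_mult)
  then show ?thesis
    using True by (simp only: if_True simp_thms integral_complex_of_real integral_monomial_diagonal[OF assms])
qed (simp add: integral_monomial_off_diagonal)

section \<open>Power series on the disc\<close>

text \<open>
  On a disc of radius less than one the partial sums are uniformly bounded, so dominated convergence
  allows integrating a power series term by term against any bounded function. Together with the
  monomial integrals this gives both the moments and the square norm of a power series.
\<close>

lemma sums_integral_power_series:
  fixes a :: "nat \<Rightarrow> complex"
  assumes r: "0 \<le> r" "r < 1"
    and f: "\<And>z. z \<in> unit_disc \<Longrightarrow> (\<lambda>k. a k * z ^ k) sums f z"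
    and u: "u \<in> borel_measurable (lebesgue_on (ball 0 r))" "\<And>z. z \<in> ball 0 r \<Longrightarrow> cmod (u z) \<le> C"
  shows "(\<lambda>k. a k * (LINT z|lebesgue_on (ball 0 r). z ^ k * u z)) sums
    (LINT z|lebesgue_on (ball 0 r). f z * u z)"
proof -
  let ?M = "lebesgue_on (ball (0::complex) r)"
  have zk: "(\<lambda>z. z ^ k) \<in> borel_measurable ?M" for k
    by (intro continuous_on_measurable_ball continuous_intros)
  have int: "integrable ?M (\<lambda>z. z ^ k * u z)" for k
  proof (rule integrable_bounded_on_ball)
    show "(\<lambda>z. z ^ k * u z) \<in> borel_measurable ?M" using zk u(1) by simp
    show "norm (z ^ k * u z) \<le> r ^ k * C" if "z \<in> ball 0 r" for z
      unfolding norm_mult norm_power using that u(2)[OF that] r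
      by (intro mult_mono power_mono) auto
  qed
  \<comment> \<open>absolute convergence at the radius \<open>r\<close> dominates all partial sums on the ball\<close>
  have "summable (\<lambda>k. norm (a k * of_real r ^ k))"
  proof (rule powser_insidea)
    show "summable (\<lambda>k. a k * of_real ((1 + r) / 2) ^ k)"
      using f[of "of_real ((1 + r) / 2)"] r by (auto simp: sums_iff simp flip: of_real_add)
    show "norm (complex_of_real r) < norm (complex_of_real ((1 + r) / 2))"
      unfolding norm_of_real using r by simp
  qed
  then have sm: "summable (\<lambda>k. cmod (a k) * r ^ k)" using r by (simp add: norm_mult norm_power)
  define B where "B = (\<Sum>k. cmod (a k) * r ^ k)"
  have part: "norm ((\<Sum>k<N. a k * z ^ k) * u z) \<le> B * C" if z: "z \<in> ball 0 r" for N z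
  proof -
    have "norm (\<Sum>k<N. a k * z ^ k) \<le> (\<Sum>k<N. cmod (a k) * cmod z ^ k)"
      by (rule order_trans[OF norm_sum]) (simp add: norm_mult norm_power)
    also have "\<dots> \<le> (\<Sum>k<N. cmod (a k) * r ^ k)"
      using z by (intro sum_mono mult_left_mono power_mono) auto
    also have "\<dots> \<le> B" unfolding B_def using r by (intro sum_le_suminf sm) auto
    finally have "norm (\<Sum>k<N. a k * z ^ k) \<le> B" .
    moreover have "0 \<le> B" unfolding B_def using r by (intro suminf_nonneg sm) auto
    ultimately show ?thesis
      unfolding norm_mult using u(2)[OF z] by (intro mult_mono) auto
  qed
  have lim: "(\<lambda>N. (\<Sum>k<N. a k * z ^ k) * u z) \<longlonglongrightarrow> f z * u z" if "z \<in> ball 0 r" for z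
    using f[of z] that r by (intro tendsto_mult tendsto_const) (auto simp: sums_def)
  have pm: "(\<lambda>z. (\<Sum>k<N. a k * z ^ k) * u z) \<in> borel_measurable ?M" for N
    using zk u(1) by simp
  have "(\<lambda>N. LINT z|?M. (\<Sum>k<N. a k * z ^ k) * u z) \<longlonglongrightarrow> (LINT z|?M. f z * u z)"
  proof (rule integral_dominated_convergence[where w="\<lambda>_. B * C"])
    show "(\<lambda>z. f z * u z) \<in> borel_measurable ?M"
      by (rule borel_measurable_LIMSEQ_metric[OF pm]) (use lim in auto)
    show "(\<lambda>z. (\<Sum>k<N. a k * z ^ k) * u z) \<in> borel_measurable ?M" for N by (rule pm)
    show "integrable ?M (\<lambda>_. B * C)" by (rule finite_measure.integrable_const) simp
  qed (use lim part in \<open>auto intro!: AE_I2\<close>)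
  also have "(\<lambda>N. LINT z|?M. (\<Sum>k<N. a k * z ^ k) * u z)
      = (\<lambda>N. \<Sum>k<N. a k * (LINT z|?M. z ^ k * u z))"
    using int by (auto simp: sum_distrib_right mult.assoc fun_eq_iff)
  finally show ?thesis by (simp add: sums_def)
qed

lemma radii_exhausting_disc:
  obtains \<rho> :: "nat \<Rightarrow> real"
  where "incseq \<rho>" "\<And>i. 0 < \<rho> i" "\<And>i. \<rho> i < 1" "\<rho> \<longlonglongrightarrow> 1" "(\<Union>i. ball (0::complex) (\<rho> i)) = unit_disc"
proof
  define \<rho> where "\<rho> = (\<lambda>i. 1 - inverse (real (Suc (Suc i))))"
  show "incseq \<rho>" by (auto simp: \<rho>_def incseq_def field_simps)
  show "0 < \<rho> i" "\<rho> i < 1" for i by (auto simp: \<rho>_def field_simps)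
  show lim: "\<rho> \<longlonglongrightarrow> 1" unfolding \<rho>_def
    using tendsto_diff[OF tendsto_const[of 1] LIMSEQ_Suc[OF LIMSEQ_inverse_real_of_nat]] by simp
  show "(\<Union>i. ball (0::complex) (\<rho> i)) = unit_disc"
  proof (intro set_eqI iffI)
    fix z :: complex assume "z \<in> unit_disc"
    then have "eventually (\<lambda>i. cmod z < \<rho> i) sequentially"
      by (intro order_tendstoD(1)[OF lim]) auto
    then show "z \<in> (\<Union>i. ball 0 (\<rho> i))" by (auto simp: eventually_sequentially)
  qed (use \<open>\<And>i. \<rho> i < 1\<close> in \<open>auto intro: less_trans\<close>)
qed

text \<open>
  Termwise integration is only available on smaller discs; integrals over the whole unit disc are
  reached by exhaustion.
\<close>

lemma integral_disc_limit:
  fixes u :: "complex \<Rightarrow> complex"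
  assumes \<rho>: "incseq \<rho>" "(\<Union>i. ball (0::complex) (\<rho> i)) = unit_disc" and u: "integrable disc_area u"
  shows "(\<lambda>i. LINT z|lebesgue_on (ball 0 (\<rho> i)). u z) \<longlonglongrightarrow> (LINT z|disc_area. u z)"
proof -
  have "(\<lambda>i. LINT z:ball 0 (\<rho> i)|lebesgue. u z) \<longlonglongrightarrow> (LINT z:(\<Union>i. ball 0 (\<rho> i))|lebesgue. u z)"
    by (rule set_integral_cont_up)
       (use \<rho>(2) u in \<open>auto simp: set_integrable_def disc_area_def integrable_restrict_space
          intro!: monoI subset_ball incseqD[OF \<rho>(1)]\<close>)
  then show ?thesis
    unfolding \<rho>(2) by (simp add: disc_area_def set_lebesgue_integral_def integral_restrict_space)
qed

lemma holomorphic_on_disc_power_series: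
  assumes "\<And>z. z \<in> unit_disc \<Longrightarrow> (\<lambda>k. a k * z ^ k) sums f z"
  shows "f holomorphic_on unit_disc"
  by (rule power_series_holomorphic[where a=a]) (use assms in auto)

lemma power_series_bounded_on_ball:
  assumes "r < 1" "\<And>z. z \<in> unit_disc \<Longrightarrow> (\<lambda>k. a k * z ^ k) sums f z"
  obtains C where "\<And>z. z \<in> ball 0 r \<Longrightarrow> cmod (f z) \<le> C"
proof -
  have "continuous_on (cball 0 r) f"
    using holomorphic_on_imp_continuous_on[OF holomorphic_on_disc_power_series[OF assms(2)]] assms(1)
    by (rule_tac continuous_on_subset) auto
  then have "bounded (f ` cball 0 r)"
    by (intro compact_imp_bounded compact_continuous_image) auto
  then obtain C where "\<And>z. z \<in> cball 0 r \<Longrightarrow> cmod (f z) \<le> C"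
    unfolding bounded_iff by blast
  then show ?thesis using that[of C] by simp
qed

lemma measurable_power_series_ball:
  assumes "r \<le> 1" "\<And>z. z \<in> unit_disc \<Longrightarrow> (\<lambda>k. a k * z ^ k) sums f z"
  shows "f \<in> borel_measurable (lebesgue_on (ball 0 r))"
  using holomorphic_on_imp_continuous_on[OF holomorphic_on_disc_power_series[OF assms(2)]] assms(1)
  by (intro continuous_on_measurable_ball) (auto elim: continuous_on_subset)

text \<open>
  Orthogonality picks out the single term \<open>a k * z ^ k\<close> of the series with \<open>k + p = q\<close>.
\<close>

lemma integral_power_series_monomial_ball:
  assumes r: "0 \<le> r" "r < 1"
    and f: "\<And>z. z \<in> unit_disc \<Longrightarrow> (\<lambda>k. a k * z ^ k) sums f z"
  shows "(LINT z|lebesgue_on (ball 0 r). f z * (z ^ p * cnj z ^ q))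
    = (if p \<le> q then a (q - p) * of_real (pi * r ^ (2 * q + 2) / (q + 1)) else 0)"
proof -
  let ?M = "lebesgue_on (ball (0::complex) r)"
  have "(\<lambda>k. a k * (LINT z|?M. z ^ k * (z ^ p * cnj z ^ q))) sums (LINT z|?M. f z * (z ^ p * cnj z ^ q))"
    by (rule sums_integral_power_series[OF r f])
       (auto intro!: continuous_on_measurable_ball continuous_intros monomial_norm_le simp del: norm_mult)
  also have "(\<lambda>k. a k * (LINT z|?M. z ^ k * (z ^ p * cnj z ^ q)))
     = (\<lambda>k. if k + p = q then a k * of_real (pi * r ^ (2 * q + 2) / (q + 1)) else 0)"
  proof
    fix k
    have "(LINT z|?M. z ^ k * (z ^ p * cnj z ^ q)) = (LINT z|?M. z ^ (k + p) * cnj z ^ q)"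
      by (simp add: power_add mult.assoc)
    then show "a k * (LINT z|?M. z ^ k * (z ^ p * cnj z ^ q))
      = (if k + p = q then a k * of_real (pi * r ^ (2 * q + 2) / (q + 1)) else 0)"
      by (auto simp only: integral_monomial[OF r(1)] mult_zero_right split: if_split)
  qed
  finally have s: "(\<lambda>k. if k + p = q then a k * of_real (pi * r ^ (2 * q + 2) / (q + 1)) else 0) sums
      (LINT z|?M. f z * (z ^ p * cnj z ^ q))" .
  show ?thesis
  proof (cases "p \<le> q")
    case True
    then have "(\<lambda>k. if k + p = q then a k * of_real (pi * r ^ (2 * q + 2) / (q + 1)) else 0)
       = (\<lambda>k. if k = q - p then a k * of_real (pi * r ^ (2 * q + 2) / (q + 1)) else 0)"
      by (auto simp: fun_eq_iff)
    then have "(\<lambda>k. if k = q - p then a k * of_real (pi * r ^ (2 * q + 2) / (q + 1)) else 0) sums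
        (LINT z|?M. f z * (z ^ p * cnj z ^ q))" using s by (simp only:)
    from sums_unique2[OF this sums_single] show ?thesis using True by (simp only: if_True)
  next
    case False
    then have "(\<lambda>k. if k + p = q then a k * of_real (pi * r ^ (2 * q + 2) / (q + 1)) else 0) = (\<lambda>_. 0)"
      by (auto simp: fun_eq_iff)
    then have "(\<lambda>_. 0) sums (LINT z|?M. f z * (z ^ p * cnj z ^ q))" using s by (simp only:)
    from sums_unique2[OF this sums_zero] show ?thesis using False by (simp only: if_False)
  qed
qed

text \<open>
  The coefficients can be read off from the moments on any small disc.
\<close>

lemma power_series_unique:
  assumes "\<And>z. z \<in> unit_disc \<Longrightarrow> (\<lambda>k. a k * z ^ k) sums f z"
    and "\<And>z. z \<in> unit_disc \<Longrightarrow> (\<lambda>k. b k * z ^ k) sums f z"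
  shows "a = b"
proof
  fix k
  have "complex_of_real (pi * (1 / 2) ^ (2 * k + 2) / real (k + 1)) \<noteq> 0"
    by (simp only: of_real_eq_0_iff) simp
  moreover have "a k * complex_of_real (pi * (1 / 2) ^ (2 * k + 2) / real (k + 1))
      = b k * complex_of_real (pi * (1 / 2) ^ (2 * k + 2) / real (k + 1))"
    using integral_power_series_monomial_ball[OF _ _ assms(1), of "1/2" 0 k]
      integral_power_series_monomial_ball[OF _ _ assms(2), of "1/2" 0 k]
    by (simp only: le0 diff_zero if_True)
  ultimately show "a k = b k" by (rule iffD1[OF mult_right_cancel])
qed

text \<open>
  Parseval on a smaller disc: integrate the series term by term against \<open>cnj (f z)\<close>, where each term is
  the conjugate of a moment of \<open>f\<close>.
\<close>

lemma integral_power_series_norm_ball: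
  assumes r: "0 \<le> r" "r < 1"
    and f: "\<And>z. z \<in> unit_disc \<Longrightarrow> (\<lambda>k. a k * z ^ k) sums f z"
  shows "(\<lambda>k. (cmod (a k))\<^sup>2 * (pi * r ^ (2 * k + 2) / (k + 1))) sums
    (LINT z|lebesgue_on (ball 0 r). (cmod (f z))\<^sup>2)"
proof -
  let ?M = "lebesgue_on (ball (0::complex) r)"
  obtain C where C: "\<And>z. z \<in> ball 0 r \<Longrightarrow> cmod (f z) \<le> C"
    using power_series_bounded_on_ball[OF r(2) f] by blast
  have fm: "f \<in> borel_measurable ?M"
    using measurable_power_series_ball[OF _ f] r by simp
  have "(\<lambda>z. cnj (f z)) \<in> borel_measurable ?M"
    by (rule measurable_compose[OF fm borel_measurable_continuous_onI]) (intro continuous_intros)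
  then have "(\<lambda>k. a k * (LINT z|?M. z ^ k * cnj (f z))) sums (LINT z|?M. f z * cnj (f z))"
    by (intro sums_integral_power_series[OF r f]) (use C in auto)
  also have "(\<lambda>k. a k * (LINT z|?M. z ^ k * cnj (f z)))
     = (\<lambda>k. of_real ((cmod (a k))\<^sup>2 * (pi * r ^ (2 * k + 2) / (k + 1))))"
  proof
    fix k
    have "(LINT z|?M. z ^ k * cnj (f z)) = (LINT z|?M. cnj (f z * (z ^ 0 * cnj z ^ k)))"
      by (simp add: mult.commute)
    also have "\<dots> = cnj (LINT z|?M. f z * (z ^ 0 * cnj z ^ k))"
      by (rule Bochner_Integration.integral_cnj)
    also have "\<dots> = cnj (a k) * of_real (pi * r ^ (2 * k + 2) / (k + 1))"
      by (simp only: integral_power_series_monomial_ball[OF r f] le0 if_True diff_zero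
        complex_cnj_mult complex_cnj_complex_of_real)
    finally show "a k * (LINT z|?M. z ^ k * cnj (f z)) = of_real ((cmod (a k))\<^sup>2 * (pi * r ^ (2 * k + 2) / (k + 1)))"
      by (simp only: of_real_mult complex_norm_square mult.assoc)
  qed
  also have "(LINT z|?M. f z * cnj (f z)) = of_real (LINT z|?M. (cmod (f z))\<^sup>2)"
    by (simp only: integral_complex_of_real[symmetric] complex_norm_square)
  finally show ?thesis by (simp only: sums_of_real_iff)
qed

text \<open>
  Parseval on the unit disc, in extended nonnegative form so that it says at once which power series
  are square integrable and what their norm is. Both sides are increasing limits of the identity on
  smaller discs.
\<close>

theorem nn_integral_power_series_disc:
  assumes f: "\<And>z. z \<in> unit_disc \<Longrightarrow> (\<lambda>k. a k * z ^ k) sums f z"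
  shows "(\<integral>\<^sup>+z. ennreal ((cmod (f z))\<^sup>2) \<partial>disc_area) = (\<Sum>k. ennreal ((cmod (a k))\<^sup>2 * (pi / (k + 1))))"
proof -
  obtain \<rho> :: "nat \<Rightarrow> real" where \<rho>: "incseq \<rho>" "\<And>i. 0 < \<rho> i" "\<And>i. \<rho> i < 1" "\<rho> \<longlonglongrightarrow> 1"
      "(\<Union>i. ball (0::complex) (\<rho> i)) = unit_disc"
    by (rule radii_exhausting_disc) blast
  let ?g = "\<lambda>z. ennreal ((cmod (f z))\<^sup>2)"
  let ?c = "\<lambda>i k. (cmod (a k))\<^sup>2 * (pi * \<rho> i ^ (2 * k + 2) / (k + 1))"
  have mono_ball: "ball (0::complex) (\<rho> i) \<subseteq> ball 0 (\<rho> j)" if "i \<le> j" for i j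
    using incseqD[OF \<rho>(1) that] by auto
  have gm: "(\<lambda>z. ?g z * indicator (ball 0 (\<rho> i)) z) \<in> borel_measurable lebesgue" for i
  proof -
    have "?g \<in> borel_measurable (lebesgue_on (ball 0 (\<rho> i)))"
      using measurable_power_series_ball[OF less_imp_le[OF \<rho>(3)] f] by simp
    then show ?thesis by (subst (asm) borel_measurable_restrict_space_iff_ennreal) auto
  qed
  have ball_val: "(\<integral>\<^sup>+z. ?g z * indicator (ball 0 (\<rho> i)) z \<partial>lebesgue) = (\<Sum>k. ennreal (?c i k))" for i
  proof -
    let ?M = "lebesgue_on (ball (0::complex) (\<rho> i))"
    obtain C where C: "\<And>z. z \<in> ball 0 (\<rho> i) \<Longrightarrow> cmod (f z) \<le> C"
      using power_series_bounded_on_ball[OF \<rho>(3) f] by blast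
    have fm: "f \<in> borel_measurable ?M"
      using measurable_power_series_ball[OF less_imp_le[OF \<rho>(3)] f] .
    have "integrable ?M (\<lambda>z. (cmod (f z))\<^sup>2)"
      by (rule integrable_bounded_on_ball[where C="C\<^sup>2"]) (use fm C in \<open>auto intro!: power_mono\<close>)
    then have "(\<integral>\<^sup>+z. ?g z \<partial>?M) = ennreal (LINT z|?M. (cmod (f z))\<^sup>2)"
      by (intro nn_integral_eq_integral) auto
    also have "\<dots> = (\<Sum>k. ennreal (?c i k))"
      by (rule suminf_ennreal_eq[symmetric])
         (use integral_power_series_norm_ball[OF less_imp_le[OF \<rho>(2)] \<rho>(3) f] \<rho>(2)[of i] in auto)
    finally show ?thesis by (subst (asm) nn_integral_restrict_space) auto
  qed
  have sup_ind: "(SUP i. ?g z * indicator (ball 0 (\<rho> i)) z) = ?g z * indicator unit_disc z" for z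
  proof (rule antisym)
    show "(SUP i. ?g z * indicator (ball 0 (\<rho> i)) z) \<le> ?g z * indicator unit_disc z"
      unfolding \<rho>(5)[symmetric] by (intro SUP_least mult_left_mono) (auto simp: indicator_def)
    show "?g z * indicator unit_disc z \<le> (SUP i. ?g z * indicator (ball 0 (\<rho> i)) z)"
    proof (cases "z \<in> unit_disc")
      case True
      then obtain i where "z \<in> ball 0 (\<rho> i)" unfolding \<rho>(5)[symmetric] by blast
      then show ?thesis using True by (intro SUP_upper2[of i]) auto
    qed simp
  qed
  have sup_coeff: "(SUP i. ennreal (?c i k)) = ennreal ((cmod (a k))\<^sup>2 * (pi / (k + 1)))" for k
  proof (rule LIMSEQ_unique[OF LIMSEQ_SUP])
    show "incseq (\<lambda>i. ennreal (?c i k))"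
      using \<rho>(2) incseqD[OF \<rho>(1)]
      by (intro monoI ennreal_leI mult_left_mono divide_right_mono power_mono) (auto intro: less_imp_le)
    have "(\<lambda>i. ?c i k) \<longlonglongrightarrow> (cmod (a k))\<^sup>2 * (pi * 1 ^ (2 * k + 2) / (k + 1))"
      by (intro tendsto_intros \<rho>(4)) auto
    then show "(\<lambda>i. ennreal (?c i k)) \<longlonglongrightarrow> ennreal ((cmod (a k))\<^sup>2 * (pi / (k + 1)))"
      by (intro tendsto_ennrealI) simp
  qed
  have "(\<integral>\<^sup>+z. ?g z \<partial>disc_area) = (\<integral>\<^sup>+z. (SUP i. ?g z * indicator (ball 0 (\<rho> i)) z) \<partial>lebesgue)"
    unfolding disc_area_def sup_ind by (rule nn_integral_restrict_space) auto
  also have "\<dots> = (SUP i. \<integral>\<^sup>+z. ?g z * indicator (ball 0 (\<rho> i)) z \<partial>lebesgue)"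
  proof (rule nn_integral_monotone_convergence_SUP)
    show "incseq (\<lambda>i z. ?g z * indicator (ball 0 (\<rho> i)) z)"
      by (intro monoI le_funI mult_left_mono indicator_leI) (erule subsetD[OF mono_ball], simp_all)
  qed (rule gm)
  also have "\<dots> = (SUP i. \<Sum>k. ennreal (?c i k))" by (simp only: ball_val)
  also have "\<dots> = (\<Sum>k. SUP i. ennreal (?c i k))"
    using \<rho>(2) incseqD[OF \<rho>(1)]
    by (intro ennreal_suminf_SUP_eq[symmetric] monoI ennreal_leI mult_left_mono divide_right_mono power_mono)
       (auto intro: less_imp_le)
  finally show ?thesis by (simp only: sup_coeff)
qed

section \<open>Square-integrable functions on the disc\<close>

lemma space_disc_area [simp]: "space disc_area = unit_disc"
  by (simp add: disc_area_def)

lemma finite_measure_disc_area: "finite_measure disc_area"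
  unfolding disc_area_def by (rule lebesgue_on_ball_finite)

lemma measurable_disc_area_continuous:
  "continuous_on unit_disc (f :: complex \<Rightarrow> complex) \<Longrightarrow> f \<in> borel_measurable disc_area"
  unfolding disc_area_def by (rule continuous_on_measurable_ball)

lemma L2_discD:
  assumes "f \<in> L2_disc"
  shows "f \<in> borel_measurable disc_area" "integrable disc_area (\<lambda>z. (cmod (f z))\<^sup>2)"
  using assms by (auto simp: L2_disc_def)

lemma L2_disc_dominated:
  assumes "g \<in> borel_measurable disc_area" "integrable disc_area B"
    and "\<And>z. z \<in> unit_disc \<Longrightarrow> (cmod (g z))\<^sup>2 \<le> B z"
  shows "g \<in> L2_disc"
  unfolding L2_disc_def
proof (intro CollectI conjI)
  show "integrable disc_area (\<lambda>z. (cmod (g z))\<^sup>2)"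
    by (rule Bochner_Integration.integrable_bound[OF assms(2)])
       (use assms(1,3) in \<open>auto intro!: AE_I2 order_trans[OF assms(3) abs_ge_self]\<close>)
qed fact

lemma L2_disc_bounded_mult:
  assumes f: "f \<in> L2_disc" and u: "u \<in> borel_measurable disc_area"
    and C: "\<And>z. z \<in> unit_disc \<Longrightarrow> cmod (u z) \<le> 1"
  shows "(\<lambda>z. u z * f z) \<in> L2_disc"
proof (rule L2_disc_dominated[OF _ L2_discD(2)[OF f]])
  show "(\<lambda>z. u z * f z) \<in> borel_measurable disc_area"
    using u L2_discD(1)[OF f] by simp
  fix z assume "z \<in> unit_disc"
  then have "cmod (u z * f z) \<le> cmod (f z)"
    using mult_right_mono[OF C norm_ge_zero] by (simp add: norm_mult)
  then show "(cmod (u z * f z))\<^sup>2 \<le> (cmod (f z))\<^sup>2" by (intro power_mono) auto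
qed

lemma L2_disc_diff:
  assumes f: "f \<in> L2_disc" and g: "g \<in> L2_disc"
  shows "(\<lambda>z. f z - g z) \<in> L2_disc"
proof (rule L2_disc_dominated)
  show "(\<lambda>z. f z - g z) \<in> borel_measurable disc_area"
    using L2_discD(1)[OF f] L2_discD(1)[OF g] by simp
  show "integrable disc_area (\<lambda>z. 2 * (cmod (f z))\<^sup>2 + 2 * (cmod (g z))\<^sup>2)"
    using L2_discD(2)[OF f] L2_discD(2)[OF g] by simp
  fix z
  have "(cmod (f z - g z))\<^sup>2 \<le> (cmod (f z) + cmod (g z))\<^sup>2"
    by (intro power_mono norm_triangle_ineq4) auto
  also have "\<dots> \<le> 2 * (cmod (f z))\<^sup>2 + 2 * (cmod (g z))\<^sup>2"
    using sum_squares_bound[of "cmod (f z)" "cmod (g z)"] by (simp add: power2_sum)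
  finally show "(cmod (f z - g z))\<^sup>2 \<le> 2 * (cmod (f z))\<^sup>2 + 2 * (cmod (g z))\<^sup>2" .
qed

lemma integrable_L2_inner:
  assumes f: "f \<in> L2_disc" and g: "g \<in> L2_disc"
  shows "integrable disc_area (\<lambda>z. f z * cnj (g z))" "integrable disc_area (\<lambda>z. cmod (f z) * cmod (g z))"
proof -
  have I: "integrable disc_area (\<lambda>z. (cmod (f z))\<^sup>2 + (cmod (g z))\<^sup>2)"
    using L2_discD(2)[OF f] L2_discD(2)[OF g] by simp
  have fm: "f \<in> borel_measurable disc_area" and gm: "g \<in> borel_measurable disc_area"
    using L2_discD(1) f g by auto
  have cm: "(\<lambda>z. cnj (g z)) \<in> borel_measurable disc_area"
    by (rule measurable_compose[OF gm borel_measurable_continuous_onI]) (intro continuous_intros)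
  have le: "cmod (f z) * cmod (g z) \<le> (cmod (f z))\<^sup>2 + (cmod (g z))\<^sup>2" for z
    using sum_squares_bound[of "cmod (f z)" "cmod (g z)"]
      mult_nonneg_nonneg[OF norm_ge_zero[of "f z"] norm_ge_zero[of "g z"]] by linarith
  show "integrable disc_area (\<lambda>z. cmod (f z) * cmod (g z))"
    by (rule Bochner_Integration.integrable_bound[OF I]) (use fm gm le in auto)
  show "integrable disc_area (\<lambda>z. f z * cnj (g z))"
    by (rule Bochner_Integration.integrable_bound[OF I]) (use fm cm le in \<open>auto simp: norm_mult\<close>)
qed

lemma L2_inner_commute: "L2_inner g f = cnj (L2_inner f g)"
  unfolding L2_inner_def
  by (subst Bochner_Integration.integral_cnj[symmetric]) (simp add: mult.commute)

lemma L2_inner_diff_left: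
  assumes "f \<in> L2_disc" "g \<in> L2_disc" "h \<in> L2_disc"
  shows "L2_inner (\<lambda>z. f z - g z) h = L2_inner f h - L2_inner g h"
  unfolding L2_inner_def using assms
  by (subst Bochner_Integration.integral_diff[symmetric]) (auto simp: integrable_L2_inner left_diff_distrib)

lemma L2_norm_nonneg: "0 \<le> L2_norm f"
  by (simp add: L2_norm_def integral_nonneg_AE)

lemma L2_norm_power2: "(L2_norm f)\<^sup>2 = (LINT z|disc_area. (cmod (f z))\<^sup>2)"
  unfolding L2_norm_def by (simp add: integral_nonneg_AE)

lemma L2_Cauchy_Schwarz:
  assumes f: "f \<in> L2_disc" and g: "g \<in> L2_disc"
  shows "cmod (L2_inner f g) \<le> L2_norm f * L2_norm g"
proof -
  let ?I = "LINT z|disc_area. cmod (f z) * cmod (g z)"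
  have fm [measurable]: "f \<in> borel_measurable disc_area" and gm [measurable]: "g \<in> borel_measurable disc_area"
    using L2_discD(1) f g by auto
  have "cmod (L2_inner f g) \<le> (LINT z|disc_area. cmod (f z * cnj (g z)))"
    unfolding L2_inner_def by (rule integral_norm_bound)
  then have 1: "cmod (L2_inner f g) \<le> ?I" by (simp add: norm_mult)
  have I0: "0 \<le> ?I" by (simp add: integral_nonneg_AE)
  have "(ennreal ?I)\<^sup>2 = (\<integral>\<^sup>+z. ennreal (cmod (f z)) * ennreal (cmod (g z)) \<partial>disc_area)\<^sup>2"
    using integrable_L2_inner(2)[OF f g] by (simp add: nn_integral_eq_integral ennreal_mult[symmetric])
  also have "\<dots> \<le> (\<integral>\<^sup>+z. (ennreal (cmod (f z)))\<^sup>2 \<partial>disc_area) * (\<integral>\<^sup>+z. (ennreal (cmod (g z)))\<^sup>2 \<partial>disc_area)"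
    by (rule Cauchy_Schwarz_nn_integral) auto
  also have "\<dots> = ennreal ((L2_norm f)\<^sup>2) * ennreal ((L2_norm g)\<^sup>2)"
    using L2_discD(2)[OF f] L2_discD(2)[OF g]
    by (simp add: ennreal_power nn_integral_eq_integral L2_norm_power2)
  finally have "?I\<^sup>2 \<le> (L2_norm f * L2_norm g)\<^sup>2"
    using I0 by (simp add: ennreal_power ennreal_mult[symmetric] power_mult_distrib)
  then have "?I \<le> L2_norm f * L2_norm g"
    by (rule power2_le_imp_le) (simp add: L2_norm_def integral_nonneg_AE)
  with 1 show ?thesis by linarith
qed

section \<open>The Bergman space as a sequence space\<close>

text \<open>
  The square norm of \<open>z ^ k\<close> on the unit disc.
\<close>

definition monomial_mass :: "nat \<Rightarrow> real"
  where "monomial_mass k = pi / real (k + 1)"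

definition taylor_coeff :: "(complex \<Rightarrow> complex) \<Rightarrow> nat \<Rightarrow> complex"
  where "taylor_coeff f k = (deriv ^^ k) f 0 / fact k"

definition disc_series :: "(nat \<Rightarrow> complex) \<Rightarrow> complex \<Rightarrow> complex"
  where "disc_series a z = (if z \<in> unit_disc then \<Sum>k. a k * z ^ k else 0)"

lemma monomial_mass_pos: "0 < monomial_mass k"
  by (simp add: monomial_mass_def)

lemma bergman_spaceD:
  assumes "f \<in> bergman_space"
  shows "f \<in> L2_disc" "f holomorphic_on unit_disc" "z \<notin> unit_disc \<Longrightarrow> f z = 0"
  using assms by (auto simp: bergman_space_def)

lemma bergman_taylor_sums:
  assumes "f \<in> bergman_space" "z \<in> unit_disc"
  shows "(\<lambda>k. taylor_coeff f k * z ^ k) sums f z"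
  using holomorphic_power_series[OF bergman_spaceD(2)[OF assms(1)] assms(2)]
  by (simp add: taylor_coeff_def)

lemma taylor_coeff_unique:
  assumes "f \<in> bergman_space" "\<And>z. z \<in> unit_disc \<Longrightarrow> (\<lambda>k. a k * z ^ k) sums f z"
  shows "taylor_coeff f = a"
  by (rule power_series_unique[OF bergman_taylor_sums[OF assms(1)] assms(2)])

lemma bergman_eqI:
  assumes "f \<in> bergman_space" "g \<in> bergman_space" "taylor_coeff f = taylor_coeff g"
  shows "f = g"
proof
  fix z show "f z = g z"
    using bergman_taylor_sums[OF assms(1), of z] bergman_taylor_sums[OF assms(2), of z] assms(3)
      bergman_spaceD(3)[OF assms(1), of z] bergman_spaceD(3)[OF assms(2), of z]
    by (cases "z \<in> unit_disc") (auto dest: sums_unique2)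
qed

lemma L2_disc_power_series:
  assumes f: "\<And>z. z \<in> unit_disc \<Longrightarrow> (\<lambda>k. a k * z ^ k) sums f z"
    and a: "summable (\<lambda>k. (cmod (a k))\<^sup>2 * monomial_mass k)"
  shows "f \<in> L2_disc" and "(L2_norm f)\<^sup>2 = (\<Sum>k. (cmod (a k))\<^sup>2 * monomial_mass k)"
proof -
  let ?S = "\<Sum>k. (cmod (a k))\<^sup>2 * monomial_mass k"
  have nonneg: "0 \<le> (cmod (a k))\<^sup>2 * monomial_mass k" for k
    using monomial_mass_pos[of k] by simp
  have fm: "f \<in> borel_measurable disc_area"
    unfolding disc_area_def by (rule measurable_power_series_ball[OF _ f]) auto
  have "(\<integral>\<^sup>+z. ennreal ((cmod (f z))\<^sup>2) \<partial>disc_area) = (\<Sum>k. ennreal ((cmod (a k))\<^sup>2 * monomial_mass k))"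
    unfolding monomial_mass_def by (rule nn_integral_power_series_disc[OF f])
  also have "\<dots> = ennreal ?S"
    by (rule suminf_ennreal2[OF nonneg a])
  finally have nn: "(\<integral>\<^sup>+z. ennreal ((cmod (f z))\<^sup>2) \<partial>disc_area) = ennreal ?S" .
  have "0 \<le> ?S" by (rule suminf_nonneg[OF a nonneg])
  then have "has_bochner_integral disc_area (\<lambda>z. (cmod (f z))\<^sup>2) ?S"
    using nn fm by (intro has_bochner_integral_nn_integral) auto
  then show "f \<in> L2_disc" "(L2_norm f)\<^sup>2 = ?S"
    using fm by (auto simp: L2_disc_def L2_norm_power2 has_bochner_integral_iff)
qed

lemma summable_taylor_coeff:
  assumes f: "f \<in> bergman_space"
  shows "summable (\<lambda>k. (cmod (taylor_coeff f k))\<^sup>2 * monomial_mass k)"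
proof (rule summable_suminf_not_top)
  show "0 \<le> (cmod (taylor_coeff f k))\<^sup>2 * monomial_mass k" for k
    using monomial_mass_pos[of k] by simp
  have "(\<Sum>k. ennreal ((cmod (taylor_coeff f k))\<^sup>2 * monomial_mass k))
      = (\<integral>\<^sup>+z. ennreal ((cmod (f z))\<^sup>2) \<partial>disc_area)"
    unfolding monomial_mass_def by (rule nn_integral_power_series_disc[OF bergman_taylor_sums[OF f], symmetric])
  also have "\<dots> \<noteq> top"
    using L2_discD(2)[OF bergman_spaceD(1)[OF f]] by (simp add: nn_integral_eq_integral)
  finally show "(\<Sum>k. ennreal ((cmod (taylor_coeff f k))\<^sup>2 * monomial_mass k)) \<noteq> top" .
qed

lemma bergman_norm_power2:
  assumes "f \<in> bergman_space"
  shows "(L2_norm f)\<^sup>2 = (\<Sum>k. (cmod (taylor_coeff f k))\<^sup>2 * monomial_mass k)"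
  by (rule L2_disc_power_series(2)[OF bergman_taylor_sums[OF assms] summable_taylor_coeff[OF assms]])

text \<open>
  The arithmetic-geometric mean inequality, applied to \<open>cmod (a k) / sqrt (k + 1)\<close> and
  \<open>sqrt (k + 1) * cmod z ^ k\<close>, dominates the series by the summable weighted squares and a
  differentiated geometric series.
\<close>

lemma power_series_converges_disc:
  assumes a: "summable (\<lambda>k. (cmod (a k))\<^sup>2 * monomial_mass k)" and z: "z \<in> unit_disc"
  shows "summable (\<lambda>k. a k * z ^ k)"
proof (rule summable_comparison_test')
  have "cmod z * cmod z < 1" using z mult_strict_mono[of "cmod z" 1 "cmod z" 1] by simp
  then have "summable (\<lambda>k. of_nat (Suc k) * (cmod z * cmod z) ^ k)"
    using geometric_deriv_sums[of "cmod z * cmod z"] by (auto simp: sums_iff)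
  then show "summable (\<lambda>k. (cmod (a k))\<^sup>2 * monomial_mass k / pi + of_nat (Suc k) * (cmod z * cmod z) ^ k)"
    by (intro summable_add summable_divide a)
  fix k
  let ?x = "cmod (a k) / sqrt (real (Suc k))" and ?y = "sqrt (real (Suc k)) * cmod z ^ k"
  have "0 \<le> ?x * ?y" by simp
  then have "norm (a k * z ^ k) \<le> 2 * ?x * ?y" by (simp add: norm_mult norm_power)
  also have "\<dots> \<le> ?x\<^sup>2 + ?y\<^sup>2" by (rule sum_squares_bound)
  also have "\<dots> = (cmod (a k))\<^sup>2 * monomial_mass k / pi + of_nat (Suc k) * (cmod z * cmod z) ^ k"
    by (simp add: monomial_mass_def power_divide power_mult_distrib power2_eq_square)
  finally show "norm (a k * z ^ k) \<le> (cmod (a k))\<^sup>2 * monomial_mass k / pi + of_nat (Suc k) * (cmod z * cmod z) ^ k" .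
qed

text \<open>
  Together with \<open>summable_taylor_coeff\<close> this identifies the Bergman space with a weighted sequence
  space, and it is the source of elements of the Bergman space in the existence arguments below.
\<close>

lemma disc_series_bergman:
  assumes a: "summable (\<lambda>k. (cmod (a k))\<^sup>2 * monomial_mass k)"
  shows "disc_series a \<in> bergman_space" and "taylor_coeff (disc_series a) = a"
proof -
  have s: "(\<lambda>k. a k * z ^ k) sums disc_series a z" if "z \<in> unit_disc" for z
    using summable_sums[OF power_series_converges_disc[OF a that]] that by (simp only: disc_series_def if_True)
  show b: "disc_series a \<in> bergman_space"
    unfolding bergman_space_def
    using L2_disc_power_series(1)[OF s a] holomorphic_on_disc_power_series[OF s]
    by (intro CollectI conjI) (assumption | simp add: disc_series_def)+
  show "taylor_coeff (disc_series a) = a" by (rule taylor_coeff_unique[OF b s])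
qed

section \<open>Inner products with monomials and the projection\<close>

lemma monomial_in_L2: "(\<lambda>z. z ^ j) \<in> L2_disc"
proof (rule L2_disc_dominated[where B="\<lambda>_. 1"])
  show "(\<lambda>z. z ^ j) \<in> borel_measurable disc_area"
    by (intro measurable_disc_area_continuous continuous_intros)
  show "integrable disc_area (\<lambda>_. 1 :: real)"
    by (rule finite_measure.integrable_const[OF finite_measure_disc_area])
  show "(cmod (z ^ j))\<^sup>2 \<le> 1" if "z \<in> unit_disc" for z
    using that by (simp add: norm_power power_le_one)
qed

lemma symbol_bounds:
  shows "(\<lambda>z. z ^ m * cnj z ^ n) \<in> borel_measurable disc_area"
    and "z \<in> unit_disc \<Longrightarrow> cmod (z ^ m * cnj z ^ n) \<le> 1"
  using monomial_norm_le[of z 1 m n]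
  by (auto intro!: measurable_disc_area_continuous continuous_intros)

lemma L2_disc_symbol_mult: "f \<in> L2_disc \<Longrightarrow> (\<lambda>z. z ^ m * cnj z ^ n * f z) \<in> L2_disc"
  by (rule L2_disc_bounded_mult[OF _ symbol_bounds])

lemma L2_inner_symbol_monomial:
  assumes f: "f \<in> bergman_space"
  shows "L2_inner (\<lambda>z. z ^ m * cnj z ^ n * f z) (\<lambda>z. z ^ j)
    = (if m \<le> n + j then taylor_coeff f (n + j - m) * of_real (monomial_mass (n + j)) else 0)"
proof -
  obtain \<rho> :: "nat \<Rightarrow> real" where \<rho>: "incseq \<rho>" "\<And>i. 0 < \<rho> i" "\<And>i. \<rho> i < 1" "\<rho> \<longlonglongrightarrow> 1"
      "(\<Union>i. ball (0::complex) (\<rho> i)) = unit_disc"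
    by (rule radii_exhausting_disc) blast
  let ?u = "\<lambda>z. f z * (z ^ m * cnj z ^ (n + j))"
  have eq: "(\<lambda>z. z ^ m * cnj z ^ n * f z * cnj (z ^ j)) = ?u"
    by (simp add: fun_eq_iff power_add mult_ac)
  have "integrable disc_area ?u"
    using integrable_L2_inner(1)[OF L2_disc_symbol_mult[OF bergman_spaceD(1)[OF f]] monomial_in_L2, of m n j]
    unfolding eq .
  then have "(\<lambda>i. LINT z|lebesgue_on (ball 0 (\<rho> i)). ?u z) \<longlonglongrightarrow> (LINT z|disc_area. ?u z)"
    by (rule integral_disc_limit[OF \<rho>(1,5)])
  moreover have "(\<lambda>i. LINT z|lebesgue_on (ball 0 (\<rho> i)). ?u z) =
      (\<lambda>i. if m \<le> n + j then taylor_coeff f (n + j - m) * of_real (pi * \<rho> i ^ (2 * (n + j) + 2) / real (n + j + 1)) else 0)"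
    by (rule ext, rule integral_power_series_monomial_ball[OF less_imp_le[OF \<rho>(2)] \<rho>(3) bergman_taylor_sums[OF f]])
  moreover have "(\<lambda>i. complex_of_real (pi * \<rho> i ^ (2 * (n + j) + 2) / real (n + j + 1)))
      \<longlonglongrightarrow> of_real (pi * 1 ^ (2 * (n + j) + 2) / real (n + j + 1))"
    by (intro tendsto_of_real tendsto_divide tendsto_mult tendsto_power tendsto_const \<rho>(4)) simp
  then have "(\<lambda>i. if m \<le> n + j then taylor_coeff f (n + j - m) * of_real (pi * \<rho> i ^ (2 * (n + j) + 2) / real (n + j + 1)) else 0)
     \<longlonglongrightarrow> (if m \<le> n + j then taylor_coeff f (n + j - m) *
      of_real (pi * 1 ^ (2 * (n + j) + 2) / real (n + j + 1)) else 0)"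
    by (cases "m \<le> n + j") (simp_all only: if_True if_False tendsto_const tendsto_mult_left)
  ultimately show ?thesis
    unfolding L2_inner_def eq monomial_mass_def
    by (simp only: LIMSEQ_unique power_one mult_1_right)
qed

lemma L2_inner_monomial:
  assumes "f \<in> bergman_space"
  shows "L2_inner f (\<lambda>z. z ^ j) = taylor_coeff f j * of_real (monomial_mass j)"
  using L2_inner_symbol_monomial[OF assms, of 0 0 j] by simp

text \<open>
  Polynomials are dense in the Bergman space: by Parseval, the square norm of the remainder of the
  Taylor series is a tail of a convergent series. Since \<open>g\<close> has the same inner product with \<open>h\<close> as with
  each remainder of \<open>h\<close>, that inner product vanishes.
\<close>

lemma orthogonal_monomials_imp_orthogonal_bergman:
  assumes g: "g \<in> L2_disc" and orth: "\<And>j. L2_inner g (\<lambda>z. z ^ j) = 0" and h: "h \<in> bergman_space"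
  shows "L2_inner g h = 0"
proof -
  let ?c = "\<lambda>k. (cmod (taylor_coeff h k))\<^sup>2 * monomial_mass k"
  let ?p = "\<lambda>N z. \<Sum>k<N. taylor_coeff h k * z ^ k"
  let ?r = "\<lambda>N z. h z - ?p N z"
  have r: "?r N \<in> L2_disc" "(L2_norm (?r N))\<^sup>2 = suminf ?c - (\<Sum>k<N. ?c k)" for N
  proof -
    have "(\<lambda>k. (taylor_coeff h k - (if k \<in> {..<N} then taylor_coeff h k else 0)) * z ^ k) sums ?r N z" if "z \<in> unit_disc" for z
      unfolding left_diff_distrib if_distrib[of "\<lambda>x. x * _"] mult_zero_left
      by (intro sums_diff bergman_taylor_sums[OF h that] sums_If_finite_set) auto
    note s = this
    have c: "(\<lambda>k. (cmod (taylor_coeff h k - (if k \<in> {..<N} then taylor_coeff h k else 0)))\<^sup>2 * monomial_mass k)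
        sums (suminf ?c - (\<Sum>k<N. ?c k))"
    proof -
      have "(\<lambda>k. ?c k - (if k \<in> {..<N} then ?c k else 0)) sums (suminf ?c - (\<Sum>k<N. ?c k))"
        by (intro sums_diff summable_sums summable_taylor_coeff h sums_If_finite_set) auto
      also have "(\<lambda>k. ?c k - (if k \<in> {..<N} then ?c k else 0)) =
          (\<lambda>k. (cmod (taylor_coeff h k - (if k \<in> {..<N} then taylor_coeff h k else 0)))\<^sup>2 * monomial_mass k)"
        by (auto simp: fun_eq_iff)
      finally show ?thesis .
    qed
    show "?r N \<in> L2_disc" "(L2_norm (?r N))\<^sup>2 = suminf ?c - (\<Sum>k<N. ?c k)"
      using L2_disc_power_series[OF s sums_summable[OF c]] sums_unique[OF c] by auto
  qed
  have eq: "L2_inner g h = L2_inner g (?r N)" for N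
  proof -
    have "(\<lambda>z. g z * cnj (?r N z)) = (\<lambda>z. g z * cnj (h z) - (\<Sum>k<N. cnj (taylor_coeff h k) * (g z * cnj (z ^ k))))"
      by (simp add: fun_eq_iff right_diff_distrib sum_distrib_left mult_ac)
    then have "L2_inner g (?r N) = L2_inner g h - (\<Sum>k<N. cnj (taylor_coeff h k) * L2_inner g (\<lambda>z. z ^ k))"
      unfolding L2_inner_def using integrable_L2_inner(1)[OF g monomial_in_L2]
        integrable_L2_inner(1)[OF g bergman_spaceD(1)[OF h]]
      by (simp only: Bochner_Integration.integral_diff Bochner_Integration.integral_sum
          Bochner_Integration.integrable_sum integrable_mult_right integral_mult_right_zero)
    then show ?thesis by (simp add: orth)
  qed
  have "(\<lambda>N. suminf ?c - (\<Sum>k<N. ?c k)) \<longlonglongrightarrow> suminf ?c - suminf ?c"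
    by (intro tendsto_diff tendsto_const summable_LIMSEQ summable_taylor_coeff h)
  then have "(\<lambda>N. (L2_norm (?r N))\<^sup>2) \<longlonglongrightarrow> 0" by (simp add: r(2))
  then have "(\<lambda>N. sqrt ((L2_norm (?r N))\<^sup>2)) \<longlonglongrightarrow> sqrt 0" by (rule tendsto_real_sqrt)
  then have "(\<lambda>N. L2_norm (?r N)) \<longlonglongrightarrow> 0" by (simp add: L2_norm_def integral_nonneg_AE)
  then have "(\<lambda>N. L2_norm g * L2_norm (?r N)) \<longlonglongrightarrow> L2_norm g * 0" by (rule tendsto_mult_left)
  then have "cmod (L2_inner g h) \<le> L2_norm g * 0"
    by (rule LIMSEQ_le_const) (use L2_Cauchy_Schwarz[OF g r(1)] eq in metis)
  then show ?thesis by simp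
qed

lemma bergman_ext:
  assumes f: "f \<in> bergman_space" and g: "g \<in> bergman_space"
    and eq: "\<And>h. h \<in> bergman_space \<Longrightarrow> L2_inner f h = L2_inner g h"
  shows "f = g"
proof (rule bergman_eqI[OF f g], rule ext)
  fix j
  let ?h = "\<lambda>z. if z \<in> unit_disc then z ^ j else 0 :: complex"
  have "?h holomorphic_on unit_disc"
    by (rule holomorphic_transform[of "\<lambda>z. z ^ j"]) (auto intro!: holomorphic_intros)
  note hol = this
  have "?h \<in> L2_disc"
  proof (rule L2_disc_dominated[OF measurable_disc_area_continuous L2_discD(2)[OF monomial_in_L2[of j]]])
    show "continuous_on unit_disc ?h" by (rule holomorphic_on_imp_continuous_on[OF hol])
  qed simp
  with hol have h: "?h \<in> bergman_space" by (simp add: bergman_space_def)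
  have "L2_inner u ?h = L2_inner u (\<lambda>z. z ^ j)" for u
    unfolding L2_inner_def by (rule Bochner_Integration.integral_cong) auto
  then have "taylor_coeff f j * of_real (monomial_mass j) = taylor_coeff g j * of_real (monomial_mass j)"
    using eq[OF h] by (simp only: L2_inner_monomial[OF f] L2_inner_monomial[OF g])
  then show "taylor_coeff f j = taylor_coeff g j"
    using monomial_mass_pos[of j] by simp
qed

text \<open>
  By density of the polynomials, the projection of \<open>g\<close> is recognised by its inner products with
  monomials alone. The second claim replaces \<open>T f\<close> by the symbol times \<open>f\<close> in inner products, which is
  how the adjoint is computed.
\<close>

lemma bergman_proj_eqI:
  assumes g: "g \<in> L2_disc" and f: "f \<in> bergman_space"
    and eq: "\<And>j. L2_inner f (\<lambda>z. z ^ j) = L2_inner g (\<lambda>z. z ^ j)"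
  shows "bergman_proj g = f" and "h \<in> bergman_space \<Longrightarrow> L2_inner f h = L2_inner g h"
proof -
  note L2 = bergman_spaceD(1)
  have orth: "L2_inner (\<lambda>z. g z - f z) h = 0" if "h \<in> bergman_space" for h
    by (rule orthogonal_monomials_imp_orthogonal_bergman[OF L2_disc_diff[OF g L2[OF f]] _ that])
       (simp add: L2_inner_diff_left[OF g L2[OF f] monomial_in_L2] eq)
  show ip: "L2_inner f h = L2_inner g h" if "h \<in> bergman_space" for h
    using orth[OF that] L2_inner_diff_left[OF g L2[OF f] L2[OF that]] by simp
  show "bergman_proj g = f"
    unfolding bergman_proj_def
  proof (rule the_equality)
    fix f' assume f': "f' \<in> bergman_space \<and> (\<forall>h\<in>bergman_space. L2_inner (\<lambda>z. g z - f' z) h = 0)"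
    show "f' = f"
    proof (rule bergman_ext)
      fix h assume h: "h \<in> bergman_space"
      have "L2_inner (\<lambda>z. g z - f' z) h = 0" using f' h by blast
      then show "L2_inner f' h = L2_inner f h"
        using L2_inner_diff_left[OF g L2 L2[OF h], of f'] f' ip[OF h] by simp
    qed (use f f' in auto)
  qed (use f orth in auto)
qed

section \<open>Toeplitz operators with monomial symbols\<close>

text \<open>
  The weights of the Toeplitz operator with symbol \<open>z ^ m * cnj z ^ n\<close> as a weighted shift: it sends
  \<open>z ^ k\<close> with \<open>k + m = n + j\<close> to this multiple of \<open>z ^ j\<close>. The index \<open>j\<close> refers to the image, and the
  value zero covers the degrees \<open>j\<close> that no \<open>k \<ge> 0\<close> reaches; there \<open>n + j - m\<close> is truncated and
  carries no meaning.
\<close>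

definition toeplitz_weight :: "nat \<Rightarrow> nat \<Rightarrow> nat \<Rightarrow> real"
  where "toeplitz_weight m n j = (if m \<le> n + j then real (j + 1) / real (n + j + 1) else 0)"

lemma summable_index_shift:
  fixes g :: "nat \<Rightarrow> real"
  assumes g: "summable g"
  shows "summable (\<lambda>j. if m \<le> n + j then g (n + j - m) else 0)"
proof (cases "m \<le> n")
  case True
  then have "(\<lambda>j. if m \<le> n + j then g (n + j - m) else 0) = (\<lambda>j. g (j + (n - m)))"
    by (auto simp: fun_eq_iff add.commute)
  then show ?thesis using summable_iff_shift[of g "n - m"] g by simp
next
  case False
  then have "(\<lambda>j. if m \<le> n + (j + (m - n)) then g (n + (j + (m - n)) - m) else 0) = g"
    by (auto simp: fun_eq_iff)
  then show ?thesis
    using summable_iff_shift[of "\<lambda>j. if m \<le> n + j then g (n + j - m) else 0" "m - n"] g by (simp only:)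
qed

text \<open>
  The weighted shift is a contraction, so its image sequence is again square summable. With
  \<open>k = n + j - m\<close> the claim is \<open>(j + 1) * (k + 1) \<le> (n + j + 1)\<^sup>2\<close>, and neither factor exceeds
  \<open>n + j + 1 = m + k + 1\<close>.
\<close>

lemma toeplitz_weight_mass_le:
  assumes "m \<le> n + j"
  shows "(toeplitz_weight m n j)\<^sup>2 * monomial_mass j \<le> monomial_mass (n + j - m)"
proof -
  let ?k = "n + j - m"
  have "real (j + 1) * real (?k + 1) \<le> real (n + j + 1) * real (n + j + 1)"
    by (intro mult_mono) auto
  then have "real (j + 1) / (real (n + j + 1) * real (n + j + 1)) \<le> 1 / real (?k + 1)"
    by (simp add: divide_simps)
  then have "pi * (real (j + 1) / (real (n + j + 1) * real (n + j + 1))) \<le> pi * (1 / real (?k + 1))"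
    by (intro mult_left_mono) auto
  moreover have "(toeplitz_weight m n j)\<^sup>2 * monomial_mass j = pi * (real (j + 1) / (real (n + j + 1) * real (n + j + 1)))"
    using assms by (simp add: toeplitz_weight_def monomial_mass_def power2_eq_square)
  ultimately show ?thesis by (simp add: monomial_mass_def)
qed

text \<open>
  The explicit series is in the Bergman space and has the same moments as the symbol times \<open>f\<close>, hence
  is its projection. Here \<open>m\<close> and \<open>n\<close> are arbitrary, so that the adjoint is covered as well.
\<close>

lemma
  fixes m n :: nat
  assumes f: "f \<in> bergman_space"
  defines "T \<equiv> toeplitz (\<lambda>z. z ^ m * cnj z ^ n)"
  shows toeplitz_monomial_bergman: "T f \<in> bergman_space"
    and toeplitz_monomial_taylor: "taylor_coeff (T f) j = of_real (toeplitz_weight m n j) * taylor_coeff f (n + j - m)"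
    and toeplitz_monomial_inner: "h \<in> bergman_space \<Longrightarrow> L2_inner (T f) h = L2_inner (\<lambda>z. z ^ m * cnj z ^ n * f z) h"
proof -
  let ?c = "\<lambda>j. of_real (toeplitz_weight m n j) * taylor_coeff f (n + j - m)"
  let ?g = "\<lambda>k. (cmod (taylor_coeff f k))\<^sup>2 * monomial_mass k"
  have sm: "summable (\<lambda>j. (cmod (?c j))\<^sup>2 * monomial_mass j)"
  proof (rule summable_comparison_test'[OF summable_index_shift[OF summable_taylor_coeff[OF f], of m n]])
    fix j
    show "norm ((cmod (?c j))\<^sup>2 * monomial_mass j) \<le> (if m \<le> n + j then ?g (n + j - m) else 0)"
    proof (cases "m \<le> n + j")
      case True
      have "(cmod (?c j))\<^sup>2 * monomial_mass j
          = (cmod (taylor_coeff f (n + j - m)))\<^sup>2 * ((toeplitz_weight m n j)\<^sup>2 * monomial_mass j)"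
        by (simp add: norm_mult power_mult_distrib)
      also have "\<dots> \<le> ?g (n + j - m)"
        using toeplitz_weight_mass_le[OF True] by (intro mult_left_mono) auto
      finally show ?thesis using True monomial_mass_pos[of j] by simp
    qed (simp add: toeplitz_weight_def)
  qed
  have s: "disc_series ?c \<in> bergman_space" "taylor_coeff (disc_series ?c) = ?c"
    by (rule disc_series_bergman[OF sm])+
  have eq: "L2_inner (disc_series ?c) (\<lambda>z. z ^ j) = L2_inner (\<lambda>z. z ^ m * cnj z ^ n * f z) (\<lambda>z. z ^ j)" for j
  proof -
    have "toeplitz_weight m n j * monomial_mass j = (if m \<le> n + j then monomial_mass (n + j) else 0)"
      by (simp add: toeplitz_weight_def monomial_mass_def)
    then have "complex_of_real (toeplitz_weight m n j) * of_real (monomial_mass j) =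
        of_real (if m \<le> n + j then monomial_mass (n + j) else 0)"
      by (simp only: of_real_mult[symmetric])
    then show ?thesis
      unfolding L2_inner_monomial[OF s(1)] L2_inner_symbol_monomial[OF f] s(2)
      by (cases "m \<le> n + j") (simp add: mult_ac, simp add: toeplitz_weight_def)
  qed
  have T: "T f = disc_series ?c"
    unfolding T_def toeplitz_def
    by (rule bergman_proj_eqI(1)[OF L2_disc_symbol_mult[OF bergman_spaceD(1)[OF f]] s(1) eq])
  show "T f \<in> bergman_space" "taylor_coeff (T f) j = ?c j"
    unfolding T using s by simp_all
  show "L2_inner (T f) h = L2_inner (\<lambda>z. z ^ m * cnj z ^ n * f z) h" if "h \<in> bergman_space"
    unfolding T
    by (rule bergman_proj_eqI(2)[OF L2_disc_symbol_mult[OF bergman_spaceD(1)[OF f]] s(1) eq that])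
qed

text \<open>
  Multiplication by a function and by its conjugate are adjoint on \<open>L2_disc\<close>, and the projection
  disappears in inner products with elements of the Bergman space.
\<close>

lemma bergman_adjoint_toeplitz_monomial:
  assumes g: "g \<in> bergman_space"
  shows "bergman_adjoint (toeplitz (\<lambda>z. z ^ m * cnj z ^ n)) g = toeplitz (\<lambda>z. z ^ n * cnj z ^ m) g"
    (is "bergman_adjoint ?T g = ?S g")
proof -
  have adj: "L2_inner (?T f) g = L2_inner f (?S g)" if f: "f \<in> bergman_space" for f
  proof -
    have "L2_inner (?T f) g = L2_inner (\<lambda>z. z ^ m * cnj z ^ n * f z) g"
      by (rule toeplitz_monomial_inner[OF f g])
    also have "\<dots> = L2_inner f (\<lambda>z. z ^ n * cnj z ^ m * g z)"
      by (simp add: L2_inner_def mult_ac)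
    also have "\<dots> = cnj (L2_inner (\<lambda>z. z ^ n * cnj z ^ m * g z) f)"
      by (rule L2_inner_commute)
    also have "\<dots> = cnj (L2_inner (?S g) f)"
      by (simp only: toeplitz_monomial_inner[OF g f])
    also have "\<dots> = L2_inner f (?S g)"
      by (rule L2_inner_commute[symmetric])
    finally show ?thesis .
  qed
  show ?thesis
    unfolding bergman_adjoint_def
  proof (rule the_equality)
    show "?S g \<in> bergman_space \<and> (\<forall>f\<in>bergman_space. L2_inner (?T f) g = L2_inner f (?S g))"
      using adj toeplitz_monomial_bergman[OF g] by blast
    fix h assume h: "h \<in> bergman_space \<and> (\<forall>f\<in>bergman_space. L2_inner (?T f) g = L2_inner f h)"
    show "h = ?S g"
    proof (rule bergman_ext)
      show "L2_inner h f = L2_inner (?S g) f" if "f \<in> bergman_space" for f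
        using h adj[OF that] that L2_inner_commute[of h f] L2_inner_commute[of "?S g" f] by simp
    qed (use h toeplitz_monomial_bergman[OF g] in auto)
  qed
qed

lemma bergman_diff:
  assumes f: "f \<in> bergman_space" and g: "g \<in> bergman_space"
  shows "(\<lambda>z. f z - g z) \<in> bergman_space"
    and "taylor_coeff (\<lambda>z. f z - g z) k = taylor_coeff f k - taylor_coeff g k"
proof -
  show b: "(\<lambda>z. f z - g z) \<in> bergman_space"
    using f g unfolding bergman_space_def by (auto intro!: holomorphic_intros L2_disc_diff)
  have "taylor_coeff (\<lambda>z. f z - g z) = (\<lambda>k. taylor_coeff f k - taylor_coeff g k)"
    by (rule taylor_coeff_unique[OF b], unfold left_diff_distrib)
       (intro sums_diff bergman_taylor_sums f g)
  then show "taylor_coeff (\<lambda>z. f z - g z) k = taylor_coeff f k - taylor_coeff g k" by simp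
qed

section \<open>The commutator\<close>

text \<open>
  In the first product the shift goes from degree \<open>j\<close> up to \<open>m + j - n\<close> and back; in the second one it
  goes first down to \<open>n + j - m\<close>.
\<close>

definition commutator_eigenvalue :: "nat \<Rightarrow> nat \<Rightarrow> nat \<Rightarrow> real"
  where "commutator_eigenvalue m n j =
    toeplitz_weight n m j * toeplitz_weight m n (m + j - n)
    - toeplitz_weight m n j * toeplitz_weight n m (n + j - m)"

text \<open>
  For a monomial annihilated by the adjoint only the first product survives. The variables are
  \<open>x = j + 1\<close>, \<open>y = n + j + 1\<close> and \<open>d = m - n\<close>; the constant \<open>1 / 2\<close> is attained at \<open>x = y = d\<close>.
\<close>

lemma eigenvalue_bounds_low_degree:
  fixes x y d :: real
  assumes "0 < x" "x \<le> d" "x \<le> y"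
  shows "\<bar>x * (x + d) / (y + d)\<^sup>2\<bar> \<le> 1 / 2"
proof -
  have "2 * (x * (x + d)) \<le> (x + d) * (x + d)"
    unfolding mult.assoc[symmetric] using assms by (intro mult_right_mono) auto
  also have "\<dots> \<le> (y + d)\<^sup>2"
    using assms by (simp add: power2_eq_square mult_mono)
  finally show ?thesis using assms by (simp add: divide_simps)
qed

text \<open>
  With the variables of the previous lemma, over the common denominator \<open>D\<close> the difference has a
  numerator \<open>N\<close> that is visibly nonnegative, and \<open>D - 2 * N\<close> becomes a sum of nonnegative terms after
  substituting \<open>x = d + s\<close> and \<open>y = d + w\<close> with \<open>0 \<le> s \<le> w\<close>.
\<close>

lemma eigenvalue_bounds_high_degree:
  fixes x y d :: real
  assumes "0 < d" "d \<le> x" "x \<le> y"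
  shows "\<bar>x * (x + d) / (y + d)\<^sup>2 - x * (x - d) / y\<^sup>2\<bar> \<le> 1 / 2"
proof -
  let ?N = "x * (x + d) * y\<^sup>2 - x * (x - d) * (y + d)\<^sup>2" and ?D = "(y + d)\<^sup>2 * y\<^sup>2"
  have D: "0 < ?D" using assms by simp
  have eq: "x * (x + d) / (y + d)\<^sup>2 - x * (x - d) / y\<^sup>2 = ?N / ?D"
    using assms by (subst diff_frac_eq) auto
  define s w where "s = x - d" and "w = y - d"
  have sw: "0 \<le> s" "s \<le> w" using assms by (auto simp: s_def w_def)
  have x: "x = d + s" and y: "y = d + w" by (auto simp: s_def w_def)
  have "?N = x * d * (2 * y * (y - x) + 2 * y * d - d * (x - d))"
    by (simp add: algebra_simps power2_eq_square)
  moreover have "d * (x - d) \<le> 2 * y * d"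
    using mult_left_mono[of "x - d" "2 * y" d] assms by (simp add: mult_ac)
  moreover have "0 \<le> 2 * y * (y - x)" using assms by (intro mult_nonneg_nonneg) auto
  moreover have "0 \<le> x * d" using assms by simp
  ultimately have N0: "0 \<le> ?N" using mult_nonneg_nonneg[of "x * d" "2 * y * (y - x) + 2 * y * d - d * (x - d)"] by linarith
  \<comment> \<open>the negative terms \<open>- 4 * d\<^sup>2 * s * w\<close> and \<open>- 4 * d * s * w\<^sup>2\<close> are absorbed into \<open>w - s\<close>\<close>
  have "?D - 2 * ?N = d ^ 3 * (4 * w + 2 * s) + d\<^sup>2 * (5 * w\<^sup>2 + 4 * (w * (w - s)) + 6 * s\<^sup>2)
      + d * (2 * w ^ 3 + 4 * (w\<^sup>2 * (w - s)) + 4 * (s\<^sup>2 * w)) + w ^ 4"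
    unfolding x y by (simp add: algebra_simps power2_eq_square power3_eq_cube power4_eq_xxxx)
  also have "\<dots> \<ge> 0"
    using assms(1) sw by (intro add_nonneg_nonneg mult_nonneg_nonneg zero_le_power) auto
  finally have "2 * ?N \<le> ?D" by simp
  then have "?N / ?D \<le> 1 / 2" by (subst pos_divide_le_eq[OF D]) simp
  moreover have "0 \<le> ?N / ?D" using N0 D by (intro divide_nonneg_pos)
  ultimately show ?thesis unfolding eq by (simp only: abs_of_nonneg)
qed

lemma abs_commutator_eigenvalue_le:
  assumes "n < m"
  shows "\<bar>commutator_eigenvalue m n j\<bar> \<le> 1 / 2"
proof -
  define x y d where "x = real (j + 1)" and "y = real (n + j + 1)" and "d = real m - real n"
  have xy: "0 < x" "x \<le> y" "0 < d" using assms by (auto simp: x_def y_def d_def)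
  have yd: "y + d = real (m + j + 1)" by (simp add: y_def d_def)
  have up: "toeplitz_weight n m j * toeplitz_weight m n (m + j - n) = x * (x + d) / (y + d)\<^sup>2"
    using assms unfolding yd
    by (simp add: toeplitz_weight_def x_def d_def of_nat_diff power2_eq_square algebra_simps)
  show ?thesis
  proof (cases "m \<le> n + j")
    case True
    then have "toeplitz_weight m n j * toeplitz_weight n m (n + j - m) = x * (x - d) / y\<^sup>2"
      by (simp add: toeplitz_weight_def x_def y_def d_def of_nat_diff power2_eq_square algebra_simps)
    moreover have "d \<le> x" using True by (simp add: d_def x_def)
    ultimately show ?thesis
      unfolding commutator_eigenvalue_def up
      using eigenvalue_bounds_high_degree[OF xy(3) _ xy(2)] by (simp only:)
  next
    case False
    then have "toeplitz_weight m n j = 0" "x \<le> d" by (auto simp: toeplitz_weight_def d_def x_def)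
    then show ?thesis
      unfolding commutator_eigenvalue_def up using eigenvalue_bounds_low_degree[of x d y] xy by simp
  qed
qed

lemma
  fixes m n :: nat
  assumes f: "f \<in> bergman_space" and nm: "n < m"
  defines "T \<equiv> toeplitz (\<lambda>z. z ^ m * cnj z ^ n)"
  shows commutator_bergman: "op_commutator (bergman_adjoint T) T f \<in> bergman_space"
    and commutator_taylor: "taylor_coeff (op_commutator (bergman_adjoint T) T f) j
      = of_real (commutator_eigenvalue m n j) * taylor_coeff f j"
proof -
  let ?S = "toeplitz (\<lambda>z. z ^ n * cnj z ^ m)"
  have Tf: "T f \<in> bergman_space" and Sf: "?S f \<in> bergman_space"
    unfolding T_def by (rule toeplitz_monomial_bergman[OF f])+
  have STf: "?S (T f) \<in> bergman_space" and TSf: "T (?S f) \<in> bergman_space"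
    unfolding T_def by (rule toeplitz_monomial_bergman[OF Tf[unfolded T_def]] toeplitz_monomial_bergman[OF Sf])+
  have C: "op_commutator (bergman_adjoint T) T f = (\<lambda>z. ?S (T f) z - T (?S f) z)"
    unfolding op_commutator_def T_def
      bergman_adjoint_toeplitz_monomial[OF f] bergman_adjoint_toeplitz_monomial[OF Tf[unfolded T_def]] ..
  show "op_commutator (bergman_adjoint T) T f \<in> bergman_space"
    unfolding C by (rule bergman_diff(1)[OF STf TSf])
  have 1: "taylor_coeff (?S (T f)) j
      = of_real (toeplitz_weight n m j * toeplitz_weight m n (m + j - n)) * taylor_coeff f j"
    using nm toeplitz_monomial_taylor[OF Tf, of n m j] toeplitz_monomial_taylor[OF f, of m n "m + j - n"]
    by (simp add: T_def)
  have 2: "taylor_coeff (T (?S f)) j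
      = of_real (toeplitz_weight m n j * toeplitz_weight n m (n + j - m)) * taylor_coeff f j"
  proof (cases "m \<le> n + j")
    case True
    then show ?thesis
      using toeplitz_monomial_taylor[OF Sf, of m n j] toeplitz_monomial_taylor[OF f, of n m "n + j - m"]
      by (simp add: T_def)
  next
    case False
    then show ?thesis
      using toeplitz_monomial_taylor[OF Sf, of m n j] by (simp add: T_def toeplitz_weight_def)
  qed
  show "taylor_coeff (op_commutator (bergman_adjoint T) T f) j
      = of_real (commutator_eigenvalue m n j) * taylor_coeff f j"
    unfolding C bergman_diff(2)[OF STf TSf] 1 2 commutator_eigenvalue_def
    by (simp add: left_diff_distrib)
qed

section \<open>The norm bound\<close>

theorem theorem14:
  fixes m n :: nat
  assumes "n < m"
  defines "T \<equiv> toeplitz (\<lambda>z. z ^ m * cnj z ^ n)"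
  shows "bergman_op_norm (op_commutator (bergman_adjoint T) T) \<le> 1 / 2"
proof -
  let ?C = "op_commutator (bergman_adjoint T) T"
  have half: "L2_norm (?C f) \<le> 1 / 2" if f: "f \<in> bergman_space" "L2_norm f \<le> 1" for f
  proof -
    let ?a = "\<lambda>k. (cmod (taylor_coeff f k))\<^sup>2 * monomial_mass k"
    have C: "?C f \<in> bergman_space"
      and tC: "\<And>k. taylor_coeff (?C f) k = of_real (commutator_eigenvalue m n k) * taylor_coeff f k"
      unfolding T_def
      by (rule commutator_bergman[OF f(1) assms(1)], rule commutator_taylor[OF f(1) assms(1)])
    have "(L2_norm (?C f))\<^sup>2 = (\<Sum>k. (cmod (taylor_coeff (?C f) k))\<^sup>2 * monomial_mass k)"
      by (rule bergman_norm_power2[OF C])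
    also have "\<dots> \<le> (\<Sum>k. (1 / 2)\<^sup>2 * ?a k)"
    proof (rule suminf_le)
      fix k
      have "(commutator_eigenvalue m n k)\<^sup>2 \<le> (1 / 2)\<^sup>2"
        using power_mono[OF abs_commutator_eigenvalue_le[OF assms(1), of k], of 2] by simp
      then show "(cmod (taylor_coeff (?C f) k))\<^sup>2 * monomial_mass k \<le> (1 / 2)\<^sup>2 * ?a k"
        unfolding tC norm_mult norm_of_real power_mult_distrib power2_abs mult.assoc
        using monomial_mass_pos[of k] by (intro mult_right_mono) auto
    qed (intro summable_taylor_coeff[OF C] summable_mult summable_taylor_coeff[OF f(1)])+
    also have "\<dots> = (1 / 2)\<^sup>2 * (L2_norm f)\<^sup>2"
      unfolding bergman_norm_power2[OF f(1)] by (rule suminf_mult[OF summable_taylor_coeff[OF f(1)]])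
    also have "\<dots> \<le> (1 / 2)\<^sup>2"
      using power_le_one[OF L2_norm_nonneg f(2), of 2] by simp
    finally show ?thesis by (rule power2_le_imp_le) simp
  qed
  have "ennreal (1 / 2) = 1 / 2"
    using divide_ennreal[of 1 2] by (simp only: ennreal_1 ennreal_numeral zero_le_one zero_less_numeral)
  then have "ennreal (L2_norm (?C f)) \<le> 1 / 2" if "f \<in> {f \<in> bergman_space. L2_norm f \<le> 1}" for f
    using ennreal_leI[OF half[of f]] that by simp
  then show ?thesis
    unfolding bergman_op_norm_def by (rule SUP_least)
qed

end
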